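(* A monotonicity constraint system (MCS) $\mathcal A$ is size-change terminating if and only if every cyclic monotonicity constraint in $\mathcal A^*$ passes the Local Termination Test.
   Context: Fix a number $n$ of variables. A monotonicity constraint (MC) is a finite conjunction of constraints $u\rhd v$ with $\rhd\in\{>,\ge\}$ and $u,v\in\{x_1,\dots,x_n,x_1',\dots,x_n'\}$ (unprimed: source; primed: target). It is identified with the labeled digraph on these $2n$ nodes having an arc $u\to v$ labeled $\rhd$ for each constraint $u\rhd v$; arcs labeled $>$ are strict, arcs labeled $\ge$ non-strict. An MCS $\mathcal A$ consists of a finite set $F$ of flow-points; a finite directed graph (control-flow graph, CFG; loops and parallel arcs allowed) on $F$; for every CFG arc $f\to g$ an MC $G$ labeling it (written $G:f\to g$); and for every flow-point $f$ an invariant $I_f$, a conjunction of constraints among $x_1,\dots,x_n$ (also viewed as labeled arcs). Multipaths: for a (finite, with at least one arc, or infinite) labeled CFG path $f_0\xrightarrow{G_1}f_1\xrightarrow{G_2}f_2\cdots$ (repetitions allowed), the corresponding $\mathcal A$-multipath is the labeled digraph with nodes $x[t,i]$ ($t$ from $0$ up to the length of the path, $1\le i\le n$), whose arcs are: for each $t\ge1$, the arcs of $G_t$ with $x_i$ renamed to $x[t-1,i]$ and $x_j'$ renamed to $x[t,j]$; and for each $t\ge0$, the arcs of $I_{f_t}$ with $x_i$ renamed to $x[t,i]$. A multipath is satisfiable if there is an assignment of elements of some well-ordered set to its nodes satisfying all constraints expressed by its arcs; a finite multipath is satisfiable iff it has no directed cycle containing a strict arc. A walk (nodes and arcs may repeat;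 arcs may be followed in any temporal direction they have) is descending if it contains a strict arc, and infinitely descending if it contains infinitely many occurrences of strict arcs. $\mathcal A$ is size-change terminating if every infinite $\mathcal A$-multipath has an infinitely descending walk. Collapse: for a finite satisfiable multipath $M=G_1\cdots G_\ell$ from $f_0$ to $f_\ell$, $\overline M$ is the MC with source $f_0$ and target $f_\ell$ consisting of all constraints among its $2n$ variables implied by $M$, where $x_i$ stands for $x[0,i]$ and $x_j'$ for $x[\ell,j]$: it has an arc $u\to v$ iff $M$ has a walk from the node of $u$ to the node of $v$, and the arc is strict iff there is such a walk that is descending. The closure set is $\mathcal A^*=\{\overline M\mid M\text{ a finite satisfiable }\mathcal A\text{-multipath}\}$. An MC is cyclic if its source and target flow-points are equal. The circular variant $G^\circ$ of a cyclic MC $G$ is the digraph obtained from $G$ by adding, for every $i$, a shortcut edge $x_i\leftrightarrow x_i'$, treated as a pair of non-strict arcs $x_i\to x_i'$ (forward direction) and $x_i'\to x_i$ (backward direction), distinguished from arcs already present in $G$. A cycle in $G^\circ$ is a closed directed walk (nodes and arcs may repeat). It is a forward cycle if it traverses shortcut edges more often in the backward direction than in the forward direction; balanced if equally often in both directions; descending if it includes a strict arc. $G$ passes the Local Termination Test if $G^\circ$ has a descending cycle that is either forward or balanced. *)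

theory Defs
  imports "HOL-Library.Extended_Nat" "HOL-Library.Countable_Set" "Graph_Theory.Arc_Walk"
begin

text \<open>
  Digraphs are those of the AFP entry Graph_Theory: finite walks are \<open>pre_digraph.awalk\<close>
  (which may be empty), closed nonempty walks are \<open>wf_digraph.closed_w\<close>; both allow
  repetition of nodes and arcs.
\<close>

section \<open>Constraints and labeled digraphs\<close>

datatype label = Gt | Ge

text \<open>A triple \<open>(u, c, v)\<close> is the constraint \<open>u > v\<close> or \<open>u \<ge> v\<close>, i.e. the arc from
  \<open>u\<close> to \<open>v\<close> labeled \<open>c\<close>.\<close>

type_synonym 'v constr = "'v \<times> label \<times> 'v"

fun strict :: "'v constr \<Rightarrow> bool" where
  "strict (u, c, v) \<longleftrightarrow> c = Gt"

type_synonym 'v ldigraph = "('v, 'v constr) pre_digraph"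

definition ldigraph :: "'v set \<Rightarrow> 'v constr set \<Rightarrow> 'v ldigraph" where
  "ldigraph V C = \<lparr> verts = V, arcs = C, tail = (\<lambda>(u, c, v). u), head = (\<lambda>(u, c, v). v) \<rparr>"

definition inf_walk :: "('v, 'a) pre_digraph \<Rightarrow> (nat \<Rightarrow> 'a) \<Rightarrow> bool" where
  "inf_walk D w \<longleftrightarrow> (\<forall>k. w k \<in> arcs D \<and> head D (w k) = tail D (w (Suc k)))"

definition descending :: "'v constr list \<Rightarrow> bool" where
  "descending w \<longleftrightarrow> (\<exists>a \<in> set w. strict a)"

definition infinitely_descending :: "(nat \<Rightarrow> 'v constr) \<Rightarrow> bool" where
  "infinitely_descending w \<longleftrightarrow> (\<exists>\<^sub>\<infinity>k. strict (w k))"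

text \<open>\<open>r\<close> is read as \<open>\<le>\<close>: \<open>(a, b) \<in> r\<close> means \<open>a \<le> b\<close>.\<close>

definition satisfies :: "'a rel \<Rightarrow> ('v \<Rightarrow> 'a) \<Rightarrow> 'v ldigraph \<Rightarrow> bool" where
  "satisfies r s M \<longleftrightarrow>
     (\<forall>x \<in> verts M. s x \<in> Field r) \<and>
     (\<forall>(u, c, v) \<in> arcs M. (s v, s u) \<in> r \<and> (c = Gt \<longrightarrow> s v \<noteq> s u))"

text \<open>HOL cannot quantify over the carrier type of the well-ordered set inside a definition.
  Taking all well-orders on sets of natural numbers, of any order type, loses nothing for
  digraphs with countably many nodes; see \<open>satisfiableI\<close> below.\<close>

definition satisfiable :: "'v ldigraph \<Rightarrow> bool" where
  "satisfiable M \<longleftrightarrow> (\<exists>(r :: nat rel) s. Well_order r \<and> satisfies r s M)"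

lemma satisfiableI:
  fixes M :: "'v::countable ldigraph" and r :: "'a rel"
  assumes wo: "Well_order r" and sat: "satisfies r s M" and "wf_digraph M"
    and ends: "tail M = (\<lambda>(u, c, v). u)" "head M = (\<lambda>(u, c, v). v)"
  shows "satisfiable M"
proof -
  define S where "S = s ` verts M"
  define g where "g = to_nat_on S"
  define r' where "r' = dir_image (Restr r S) g"
  have S: "S \<subseteq> Field r" using sat by (auto simp: S_def satisfies_def)
  have "countable S" unfolding S_def by simp
  then have inj: "inj_on g S" unfolding g_def by (rule inj_on_to_nat_on)
  have F: "Field (Restr r S) = S"
    using Refl_Field_Restr2[OF _ S] wo by (simp add: order_on_defs)
  have "Well_order r'" unfolding r'_def
    by (rule Well_order_dir_image[OF Well_order_Restr[OF wo]]) (simp only: F inj)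
  moreover have "satisfies r' (g \<circ> s) M"
    unfolding satisfies_def
  proof (intro conjI ballI)
    fix x assume "x \<in> verts M"
    then show "(g \<circ> s) x \<in> Field r'"
      unfolding r'_def dir_image_Field F by (auto simp: S_def)
  next
    fix a assume a: "a \<in> arcs M"
    obtain u c v where [simp]: "a = (u, c, v)" by (cases a)
    have uv: "u \<in> verts M" "v \<in> verts M"
      using wf_digraph.wellformed[OF \<open>wf_digraph M\<close> a] by (simp_all add: ends)
    then have "s u \<in> S" "s v \<in> S" by (auto simp: S_def)
    moreover have "(s v, s u) \<in> r" "c = Gt \<longrightarrow> s v \<noteq> s u"
      using sat a by (auto simp: satisfies_def)
    ultimately show "case a of (u, c, v) \<Rightarrow>
        ((g \<circ> s) v, (g \<circ> s) u) \<in> r' \<and> (c = Gt \<longrightarrow> (g \<circ> s) v \<noteq> (g \<circ> s) u)"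
      using inj by (auto simp: r'_def dir_image_def dest: inj_onD)
  qed
  ultimately show ?thesis unfolding satisfiable_def by blast
qed


section \<open>Monotonicity constraint systems\<close>

text \<open>\<open>Src i\<close> and \<open>Tgt i\<close> are the variables \<open>x\<^sub>i\<close> and \<open>x\<^sub>i'\<close>, where \<open>1 \<le> i \<le> n\<close>.\<close>

datatype var = Src nat | Tgt nat

type_synonym mc = "var constr set"

definition mc_vars :: "nat \<Rightarrow> var set" where
  "mc_vars n = Src ` {1..n} \<union> Tgt ` {1..n}"

text \<open>CFG arcs have identities of their own, so parallel arcs are possible. A constraint
  \<open>(i, c, j)\<close> in an invariant relates \<open>x\<^sub>i\<close> and \<open>x\<^sub>j\<close>.\<close>

record ('f, 'e) mcs =
  cfg :: "('f, 'e) pre_digraph"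
  mc_of :: "'e \<Rightarrow> mc"
  inv_of :: "'f \<Rightarrow> nat constr set"

definition mcs :: "nat \<Rightarrow> ('f, 'e) mcs \<Rightarrow> bool" where
  "mcs n A \<longleftrightarrow> fin_digraph (cfg A) \<and>
     (\<forall>e \<in> arcs (cfg A). mc_of A e \<subseteq> mc_vars n \<times> UNIV \<times> mc_vars n) \<and>
     (\<forall>f \<in> verts (cfg A). inv_of A f \<subseteq> {1..n} \<times> UNIV \<times> {1..n})"


section \<open>Multipaths\<close>

text \<open>A CFG path with \<open>l\<close> arcs, finite or infinite; its arcs are \<open>p 0, p 1, \<dots>\<close>
  (so \<open>p t\<close> carries \<open>G\<^sub>t\<^sub>+\<^sub>1\<close>), and values of \<open>p\<close> from \<open>l\<close> on are ignored.\<close>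

definition cfg_path :: "('f, 'e) mcs \<Rightarrow> enat \<Rightarrow> (nat \<Rightarrow> 'e) \<Rightarrow> bool" where
  "cfg_path A l p \<longleftrightarrow> 1 \<le> l \<and>
     (\<forall>t. enat t < l \<longrightarrow> p t \<in> arcs (cfg A)) \<and>
     (\<forall>t. enat (Suc t) < l \<longrightarrow> head (cfg A) (p t) = tail (cfg A) (p (Suc t)))"

fun flow_point :: "('f, 'e) mcs \<Rightarrow> (nat \<Rightarrow> 'e) \<Rightarrow> nat \<Rightarrow> 'f" where
  "flow_point A p 0 = tail (cfg A) (p 0)"
| "flow_point A p (Suc t) = head (cfg A) (p t)"

text \<open>The node \<open>x[t,i]\<close> is \<open>(t, i)\<close>. The node of a variable of an MC that spans times
  \<open>t\<close> to \<open>t'\<close>:\<close>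

fun node :: "nat \<Rightarrow> nat \<Rightarrow> var \<Rightarrow> nat \<times> nat" where
  "node t t' (Src i) = (t, i)"
| "node t t' (Tgt i) = (t', i)"

definition multipath ::
  "nat \<Rightarrow> ('f, 'e) mcs \<Rightarrow> enat \<Rightarrow> (nat \<Rightarrow> 'e) \<Rightarrow> (nat \<times> nat) ldigraph" where
  "multipath n A l p = ldigraph
     {(t, i). enat t \<le> l \<and> i \<in> {1..n}}
     ({(node t (Suc t) u, c, node t (Suc t) v) | t u c v.
         enat t < l \<and> (u, c, v) \<in> mc_of A (p t)} \<union>
      {((t, i), c, (t, j)) | t i c j.
         enat t \<le> l \<and> (i, c, j) \<in> inv_of A (flow_point A p t)})"

definition size_change_terminating :: "nat \<Rightarrow> ('f, 'e) mcs \<Rightarrow> bool" where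
  "size_change_terminating n A \<longleftrightarrow>
     (\<forall>p. cfg_path A \<infinity> p \<longrightarrow>
        (\<exists>w. inf_walk (multipath n A \<infinity> p) w \<and> infinitely_descending w))"


section \<open>Collapse and closure set\<close>

definition collapse :: "nat \<Rightarrow> ('f, 'e) mcs \<Rightarrow> nat \<Rightarrow> (nat \<Rightarrow> 'e) \<Rightarrow> mc" where
  "collapse n A l p =
     {(u, c, v). u \<in> mc_vars n \<and> v \<in> mc_vars n \<and>
        (\<exists>w. pre_digraph.awalk (multipath n A (enat l) p) (node 0 l u) w (node 0 l v)) \<and>
        (c = Gt \<longleftrightarrow>
          (\<exists>w. pre_digraph.awalk (multipath n A (enat l) p) (node 0 l u) w (node 0 l v) \<and>
               descending w))}"

text \<open>Elements are MCs together with their source and target flow-points.\<close>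

definition closure_set :: "nat \<Rightarrow> ('f, 'e) mcs \<Rightarrow> ('f \<times> mc \<times> 'f) set" where
  "closure_set n A =
     {(flow_point A p 0, collapse n A l p, flow_point A p l) | l p.
        cfg_path A (enat l) p \<and> satisfiable (multipath n A (enat l) p)}"

definition cyclic :: "'f \<times> mc \<times> 'f \<Rightarrow> bool" where
  "cyclic = (\<lambda>(f, G, g). f = g)"


section \<open>The Local Termination Test\<close>

text \<open>\<open>Forward i\<close> and \<open>Backward i\<close> are the two directions of the shortcut edge between
  \<open>x\<^sub>i\<close> and \<open>x\<^sub>i'\<close>; the datatype keeps them distinct from arcs of \<open>G\<close> with the same ends.\<close>

datatype circ_arc = Arc "var constr" | Forward nat | Backward nat

fun circ_tail :: "circ_arc \<Rightarrow> var" where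
  "circ_tail (Arc (u, c, v)) = u"
| "circ_tail (Forward i) = Src i"
| "circ_tail (Backward i) = Tgt i"

fun circ_head :: "circ_arc \<Rightarrow> var" where
  "circ_head (Arc (u, c, v)) = v"
| "circ_head (Forward i) = Tgt i"
| "circ_head (Backward i) = Src i"

definition circular_variant :: "nat \<Rightarrow> mc \<Rightarrow> (var, circ_arc) pre_digraph" where
  "circular_variant n G =
     \<lparr> verts = mc_vars n,
       arcs = Arc ` G \<union> Forward ` {1..n} \<union> Backward ` {1..n},
       tail = circ_tail, head = circ_head \<rparr>"

text \<open>This is the library's \<open>closed_w\<close>, whose equation is available only under
  \<open>wf_digraph\<close>. The library's \<open>cycle\<close> forbids repeated nodes.\<close>

definition is_cycle :: "('v, 'a) pre_digraph \<Rightarrow> 'a list \<Rightarrow> bool" where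
  "is_cycle D w \<longleftrightarrow> w \<noteq> [] \<and> (\<exists>u. pre_digraph.awalk D u w u)"

definition num_forward :: "circ_arc list \<Rightarrow> nat" where
  "num_forward w = length (filter (\<lambda>a. \<exists>i. a = Forward i) w)"

definition num_backward :: "circ_arc list \<Rightarrow> nat" where
  "num_backward w = length (filter (\<lambda>a. \<exists>i. a = Backward i) w)"

definition forward_cycle :: "circ_arc list \<Rightarrow> bool" where
  "forward_cycle w \<longleftrightarrow> num_backward w > num_forward w"

definition balanced_cycle :: "circ_arc list \<Rightarrow> bool" where
  "balanced_cycle w \<longleftrightarrow> num_backward w = num_forward w"

definition descending_cycle :: "circ_arc list \<Rightarrow> bool" where
  "descending_cycle w \<longleftrightarrow> (\<exists>a. Arc a \<in> set w \<and> strict a)"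

definition passes_local_termination_test :: "nat \<Rightarrow> mc \<Rightarrow> bool" where
  "passes_local_termination_test n G \<longleftrightarrow>
     (\<exists>w. is_cycle (circular_variant n G) w \<and> descending_cycle w \<and>
          (forward_cycle w \<or> balanced_cycle w))"

end

theory Submission
  imports Defs "HOL-Library.Ramsey"
begin

text \<open>
  Suppose that an infinite multipath is cut into consecutive segments that all collapse to the
  same MC \<open>G\<close>. The target variables of one copy of \<open>G\<close> are the source variables of the next, so
  the shortcut edges of the circular variant cost nothing: going backward over one means moving
  to the next copy, going forward means moving to the previous one. Thus a descending cycle that
  is forward or balanced, started far enough from time 0 and repeated, unfolds to an infinitely
  descending walk. Conversely, if the segments are satisfiable, an infinitely descending walk
  meets the segment boundaries infinitely often, hence infinitely often at the same variable;
  a visit in the earliest possible copy and a later one with a strict arc in between fold to a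
  cycle that passes the test.

  Such multipaths arise by repeating a cyclic satisfiable multipath forever, and, by Ramsey's
  theorem, by cutting an arbitrary infinite multipath. In the latter case, if there is no
  infinitely descending walk, then a segment has no descending cycle and is satisfiable, so \<open>G\<close>
  belongs to the closure set.
\<close>

section \<open>Walks in labeled digraphs\<close>

lemma ldigraph_simps [simp]:
  "verts (ldigraph V C) = V" "arcs (ldigraph V C) = C"
  "tail (ldigraph V C) (u, c, v) = u" "head (ldigraph V C) (u, c, v) = v"
  by (simp_all add: ldigraph_def)

lemma wf_digraph_ldigraph_iff:
  "wf_digraph (ldigraph V C) \<longleftrightarrow> (\<forall>(u, c, v) \<in> C. u \<in> V \<and> v \<in> V)"
  by (force simp: wf_digraph_def)

lemma strict_iff: "strict a \<longleftrightarrow> fst (snd a) = Gt"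
  by (cases a) simp

lemma descending_simps [simp]:
  "descending [] \<longleftrightarrow> False" "descending (a # w) \<longleftrightarrow> strict a \<or> descending w"
  "descending (w @ w') \<longleftrightarrow> descending w \<or> descending w'"
  by (auto simp: descending_def)

lemma (in pre_digraph) cas_nth:
  "cas u w v \<Longrightarrow> Suc k < length w \<Longrightarrow> head G (w ! k) = tail G (w ! Suc k)"
proof (induction w arbitrary: u k)
  case (Cons a w)
  then show ?case by (cases k; cases w) auto
qed simp

lemma (in pre_digraph) cas_append:
  "cas u w v \<Longrightarrow> cas v w' x \<Longrightarrow> cas u (w @ w') x"
  by (induction w arbitrary: u) auto

lemma (in pre_digraph) awalk_append:
  "awalk u w v \<Longrightarrow> awalk v w' x \<Longrightarrow> awalk u (w @ w') x"
  unfolding awalk_def by (auto simp del: cas_append_iff intro: cas_append)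

lemma (in wf_digraph) awalk_arc: "a \<in> arcs G \<Longrightarrow> awalk (tail G a) [a] (head G a)"
  by (simp add: awalk_Cons_iff awalk_Nil_iff)

definition map_arc :: "('v \<Rightarrow> 'u) \<Rightarrow> 'v constr \<Rightarrow> 'u constr" where
  "map_arc f = (\<lambda>(u, c, v). (f u, c, f v))"

lemma strict_map_arc [simp]: "strict (map_arc f a) \<longleftrightarrow> strict a"
  by (cases a) (simp add: map_arc_def)

lemma descending_map_arc [simp]: "descending (map (map_arc f) w) \<longleftrightarrow> descending w"
  by (simp add: descending_def)

text \<open>A node map that sends arcs to arcs with the same label is a homomorphism, so it carries
  walks to walks arc by arc. It is applied to time shifts and, with the identity, to inclusions of
  digraphs.\<close>

lemma awalk_map_arc:
  assumes "pre_digraph.awalk (ldigraph V C) u w v"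
    and V: "\<And>x. x \<in> V \<Longrightarrow> f x \<in> V'"
    and C: "\<And>x c y. (x, c, y) \<in> C \<Longrightarrow> (f x, c, f y) \<in> C'"
  shows "pre_digraph.awalk (ldigraph V' C') (f u) (map (map_arc f) w) (f v)"
proof -
  have "pre_digraph.cas (ldigraph V C) u w v \<Longrightarrow>
      pre_digraph.cas (ldigraph V' C') (f u) (map (map_arc f) w) (f v)" for u
    by (induction w arbitrary: u) (auto simp: pre_digraph.cas.simps map_arc_def)
  then show ?thesis
    using assms(1) V C by (auto simp: pre_digraph.awalk_def map_arc_def)
qed

text \<open>A descending walk is not empty, so the concatenations of the first \<open>k\<close>
  walks grow without bound and have an infinite limit, to which each \<open>W k\<close> contributes
  a strict arc.\<close>

lemma infinitely_descending_concat:
  fixes D :: "'v ldigraph"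
  assumes W: "\<And>k. pre_digraph.awalk D (v k) (W k) (v (Suc k))"
    and desc: "\<And>k. descending (W k)"
  shows "\<exists>w. inf_walk D w \<and> infinitely_descending w"
proof -
  define L where "L k = concat (map W [0..<k])" for k
  \<comment> \<open>\<open>L (Suc i)\<close> has at least \<open>Suc i\<close> arcs, so position
    \<open>i\<close> exists in it.\<close>
  define w where "w i = L (Suc i) ! i" for i
  have L_Suc: "L (Suc k) = L k @ W k" for k
    by (simp add: L_def)
  have L_walk: "pre_digraph.awalk D (v 0) (L k) (v k)" for k
  proof (induction k)
    case 0
    show ?case using W[of 0] by (simp add: L_def pre_digraph.awalk_def pre_digraph.cas.simps)
  next
    case (Suc k)
    then show ?case unfolding L_Suc using W by (rule pre_digraph.awalk_append)
  qed
  have len: "k \<le> length (L k)" for k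
  proof (induction k)
    case (Suc k)
    moreover have "W k \<noteq> []" using desc[of k] by auto
    ultimately show ?case by (cases "W k") (simp_all add: L_Suc)
  qed simp
  have L_prefix: "\<exists>r. L m = L k @ r" if "k \<le> m" for k m
    using that by (induction rule: dec_induct) (auto simp: L_Suc)
  have w_nth: "w i = L m ! i" if "i < length (L m)" for i m
  proof -
    have "i < length (L (Suc i))" using len[of "Suc i"] by simp
    then show ?thesis unfolding w_def
      using L_prefix[of m "Suc i"] L_prefix[of "Suc i" m] that
      by (cases "m \<le> Suc i") (auto simp: nth_append)
  qed
  have "inf_walk D w"
    unfolding inf_walk_def
  proof (intro allI)
    fix k
    have l: "Suc k < length (L (Suc (Suc k)))" using len[of "Suc (Suc k)"] by simp
    then show "w k \<in> arcs D \<and> head D (w k) = tail D (w (Suc k))"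
      using L_walk[of "Suc (Suc k)"] pre_digraph.cas_nth[OF _ l, of D "v 0"]
      by (auto simp: w_nth[OF l] w_nth[OF Suc_lessD[OF l]] pre_digraph.awalk_def)
  qed
  moreover have "infinitely_descending w"
    unfolding infinitely_descending_def INFM_nat_le
  proof
    fix m
    obtain j where j: "j < length (W m)" "strict (W m ! j)"
      using desc[of m] by (auto simp: descending_def in_set_conv_nth)
    have "w (length (L m) + j) = W m ! j"
      using j by (subst w_nth[of _ "Suc m"]) (auto simp: L_Suc)
    then show "\<exists>k\<ge>m. strict (w k)"
      using j len[of m] by (metis trans_le_add1)
  qed
  ultimately show ?thesis by blast
qed

section \<open>Satisfiability and descending walks\<close>

text \<open>Along the walk the assigned values never increase. Once the least of them has been
  attained, a later strict arc would lead below it.\<close>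

lemma satisfiable_imp_not_infinitely_descending:
  assumes sat: "satisfiable (ldigraph V C)" and w: "inf_walk (ldigraph V C) w"
  shows "\<not> infinitely_descending w"
proof
  assume inf: "infinitely_descending w"
  obtain r :: "nat rel" and s where wo: "Well_order r" and s: "satisfies r s (ldigraph V C)"
    using sat unfolding satisfiable_def by blast
  define h where "h k = s (tail (ldigraph V C) (w k))" for k
  have r: "refl_on (Field r) r" "trans r" "antisym r" "wf (r - Id)"
    using wo by (auto simp: order_on_defs)
  have arc: "(h (Suc k), h k) \<in> r \<and> (strict (w k) \<longrightarrow> h (Suc k) \<noteq> h k)" for k
  proof -
    obtain u c v where a: "w k = (u, c, v)" by (cases "w k")
    have "(u, c, v) \<in> C" "tail (ldigraph V C) (w (Suc k)) = v"
      using w a unfolding inf_walk_def by (metis ldigraph_simps)+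
    then show ?thesis using s a by (auto simp: satisfies_def h_def)
  qed
  have mono: "(h m, h k) \<in> r" if "k \<le> m" for k m
    using that
  proof (induction rule: dec_induct)
    case base
    have "h k \<in> Field r" using arc[of k] by (auto simp: Field_def)
    then show ?case using r by (simp add: refl_on_def)
  next
    case (step m)
    then show ?case using transD[OF r(2)] arc[of m] by blast
  qed
  obtain z where z: "z \<in> range h" and min: "\<And>y. (y, z) \<in> r - Id \<Longrightarrow> y \<notin> range h"
    using wfE_min[OF r(4), of "h 0" "range h"] by blast
  obtain k where k: "z = h k" using z by blast
  obtain m where m: "k \<le> m" "strict (w m)"
    using inf unfolding infinitely_descending_def INFM_nat_le by blast
  have "h m = h k" using min mono[OF m(1)] k by blast
  then have "(h (Suc m), h k) \<in> r - Id" using arc[of m] m by auto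
  then show False using min k by blast
qed

text \<open>Each node gets as value the number of nodes reachable from it by a descending walk.
  Along an arc from \<open>u\<close> to \<open>v\<close> the reachable set can only shrink; along a
  strict arc it loses \<open>v\<close> itself, as \<open>v\<close> lies on no descending
  cycle.\<close>

lemma satisfiable_if_no_descending_cycle:
  assumes fin: "finite V" and wf: "wf_digraph (ldigraph V C)"
    and acyc: "\<And>u w. pre_digraph.awalk (ldigraph V C) u w u \<Longrightarrow> \<not> descending w"
  shows "satisfiable (ldigraph V C)"
proof -
  interpret wf_digraph "ldigraph V C" by (rule wf)
  define below where "below u = {v \<in> V. \<exists>w. awalk u w v \<and> descending w}" for u
  have fin_below: "finite (below u)" for u
    using fin by (simp add: below_def)
  have "card (below v) \<le> card (below u) \<and> (c = Gt \<longrightarrow> card (below v) \<noteq> card (below u))"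
    if a: "(u, c, v) \<in> C" for u c v
  proof -
    have a': "awalk u [(u, c, v)] v" using awalk_arc[of "(u, c, v)"] a by simp
    have sub: "below v \<subseteq> below u"
    proof
      fix x assume "x \<in> below v"
      then obtain w where "x \<in> V" "awalk v w x" "descending w" by (auto simp: below_def)
      moreover from this have "awalk u ([(u, c, v)] @ w) x" using a' awalk_append by blast
      ultimately show "x \<in> below u"
        unfolding below_def by (metis (mono_tags, lifting) descending_simps(3) mem_Collect_eq)
    qed
    have "below v \<subset> below u" if "c = Gt"
    proof -
      have "v \<in> V" "descending [(u, c, v)]" using awalk_last_in_verts[OF a'] that by simp_all
      then have "v \<in> below u" using a' unfolding below_def by blast
      moreover have "v \<notin> below v" using acyc unfolding below_def by blast
      ultimately show ?thesis using sub by blast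
    qed
    then show ?thesis
      using card_mono[OF fin_below sub] psubset_card_mono[OF fin_below, of "below v" u] by auto
  qed
  then have "satisfies natLeq (\<lambda>u. card (below u)) (ldigraph V C)"
    unfolding satisfies_def Field_natLeq by (auto simp: natLeq_def)
  then show ?thesis unfolding satisfiable_def using natLeq_Well_order by blast
qed


section \<open>Windows of an infinite multipath\<close>

text \<open>The segment of a multipath between times \<open>a\<close> and \<open>b\<close>, with nodes keeping their absolute
  times. It omits the arcs at times \<open>a\<close> and \<open>b\<close> that come from MCs outside the segment.\<close>

definition window_arcs ::
  "('f, 'e) mcs \<Rightarrow> (nat \<Rightarrow> 'e) \<Rightarrow> nat \<Rightarrow> nat \<Rightarrow> (nat \<times> nat) constr set" where
  "window_arcs A p a b =
     {(node t (Suc t) u, c, node t (Suc t) v) | t u c v.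
         a \<le> t \<and> t < b \<and> (u, c, v) \<in> mc_of A (p t)} \<union>
     {((t, i), c, (t, j)) | t i c j.
         a \<le> t \<and> t \<le> b \<and> (i, c, j) \<in> inv_of A (flow_point A p t)}"

definition window ::
  "nat \<Rightarrow> ('f, 'e) mcs \<Rightarrow> (nat \<Rightarrow> 'e) \<Rightarrow> nat \<Rightarrow> nat \<Rightarrow> (nat \<times> nat) ldigraph" where
  "window n A p a b = ldigraph ({a..b} \<times> {1..n}) (window_arcs A p a b)"

lemma multipath_eq_window: "multipath n A (enat l) p = window n A p 0 l"
  unfolding multipath_def window_def window_arcs_def
  by (rule arg_cong2[where f = ldigraph]) auto

lemma node_in_window: "u \<in> mc_vars n \<Longrightarrow> a \<le> b \<Longrightarrow> node a b u \<in> {a..b} \<times> {1..n}"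
  by (cases u) (auto simp: mc_vars_def)

lemma multipath_cong:
  assumes "l > 0" "\<And>t. t < l \<Longrightarrow> p t = q t"
  shows "multipath n A (enat l) p = multipath n A (enat l) q"
proof -
  \<comment> \<open>The flow-point at time 0 is read off the tail of \<open>p 0\<close>, so
    agreement there uses \<open>l > 0\<close>.\<close>
  have "flow_point A p t = flow_point A q t" if "t \<le> l" for t
    using that assms by (cases t) auto
  then show ?thesis
    using assms(2) by (simp add: multipath_eq_window window_def window_arcs_def cong: conj_cong)
qed

lemma collapse_subset: "collapse n A l p \<subseteq> mc_vars n \<times> UNIV \<times> mc_vars n"
  by (auto simp: collapse_def)

lemma closure_setI:
  "cfg_path A (enat l) p \<Longrightarrow> satisfiable (multipath n A (enat l) p) \<Longrightarrow>
     (flow_point A p 0, collapse n A l p, flow_point A p l) \<in> closure_set n A"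
  unfolding closure_set_def by blast

locale mcs_path =
  fixes n :: nat and A :: "('f, 'e) mcs" and p :: "nat \<Rightarrow> 'e"
  assumes mcs: "mcs n A" and path: "cfg_path A \<infinity> p"
begin

lemma flow_point_in_verts: "flow_point A p t \<in> verts (cfg A)"
proof -
  interpret fin_digraph "cfg A" using mcs by (simp add: mcs_def)
  show ?thesis using path by (cases t) (auto simp: cfg_path_def)
qed

lemma mc_of_subset: "mc_of A (p t) \<subseteq> mc_vars n \<times> UNIV \<times> mc_vars n"
  using mcs path by (simp add: mcs_def cfg_path_def)

lemma inv_of_subset: "inv_of A (flow_point A p t) \<subseteq> {1..n} \<times> UNIV \<times> {1..n}"
  using mcs flow_point_in_verts by (simp add: mcs_def)

text \<open>The definition reads the starting point off a tail and later points off heads; on an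
  infinite path tails serve throughout, which makes the formula stable under shifts.\<close>

lemma flow_point_eq_tail: "flow_point A p t = tail (cfg A) (p t)"
  using path by (cases t) (simp_all add: cfg_path_def)

lemma flow_point_shift: "flow_point A (\<lambda>t. p (a + t)) t = flow_point A p (a + t)"
  by (cases t) (simp_all add: flow_point_eq_tail)

lemma shift_path: "mcs_path n A (\<lambda>t. p (a + t))"
  using mcs path by unfold_locales (auto simp: cfg_path_def)

lemma mc_arc_nodes:
  "(u, c, v) \<in> mc_of A (p t) \<Longrightarrow>
     node t (Suc t) u \<in> {t..Suc t} \<times> {1..n} \<and> node t (Suc t) v \<in> {t..Suc t} \<times> {1..n}"
  using mc_of_subset[of t] node_in_window[of _ n t "Suc t"] by fastforce

lemma inv_arc_ends:
  "(i, c, j) \<in> inv_of A (flow_point A p t) \<Longrightarrow> i \<in> {1..n} \<and> j \<in> {1..n}"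
  using inv_of_subset[of t] by auto

lemma wf_window: "wf_digraph (window n A p a b)"
  unfolding window_def wf_digraph_ldigraph_iff window_arcs_def
  by (auto simp: mem_Times_iff dest!: mc_arc_nodes inv_arc_ends)

lemma window_arc_ends:
  "(x, c, y) \<in> window_arcs A p a b \<Longrightarrow> x \<in> {a..b} \<times> {1..n} \<and> y \<in> {a..b} \<times> {1..n}"
  using wf_window[of a b] unfolding window_def wf_digraph_ldigraph_iff by blast

lemma multipath_eq:
  "multipath n A \<infinity> p = ldigraph (UNIV \<times> {1..n}) (arcs (multipath n A \<infinity> p))"
  unfolding multipath_def ldigraph_simps by (rule arg_cong2[where f = ldigraph]) auto

lemma wf_multipath: "wf_digraph (multipath n A \<infinity> p)"
  by (subst multipath_eq, unfold wf_digraph_ldigraph_iff multipath_def)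
    (auto simp: mem_Times_iff dest!: mc_arc_nodes inv_arc_ends)

lemma window_arcs_subset: "window_arcs A p a b \<subseteq> arcs (multipath n A \<infinity> p)"
  by (auto simp: window_arcs_def multipath_def)

lemma awalk_window_imp_awalk_multipath:
  assumes "pre_digraph.awalk (window n A p a b) u w v"
  shows "pre_digraph.awalk (multipath n A \<infinity> p) u w v"
proof -
  have "pre_digraph.awalk (multipath n A \<infinity> p) (id u) (map (map_arc id) w) (id v)"
    using assms unfolding window_def
    by (subst multipath_eq, elim awalk_map_arc) (auto dest: subsetD[OF window_arcs_subset])
  moreover have "map (map_arc id) w = w" by (rule map_idI) (auto simp: map_arc_def)
  ultimately show ?thesis by simp
qed

section \<open>Moving a window to time 0\<close>

lemma window_arcs_shift:
  "window_arcs A p a (a + l) =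
     map_arc (map_prod ((+) a) id) ` window_arcs A (\<lambda>t. p (a + t)) 0 l" (is "?L = ?f ` ?R")
proof
  have node: "map_prod ((+) a) id (node t t' u) = node (a + t) (a + t') u" for t t' u
    by (cases u) simp_all
  show "?f ` ?R \<subseteq> ?L"
    by (auto simp: window_arcs_def map_arc_def node flow_point_shift)
  \<comment> \<open>Times in the window are at least \<open>a\<close>, so the truncated subtraction
    \<open>t - a\<close> is exact.\<close>
  show "?L \<subseteq> ?f ` ?R"
  proof
    fix x assume "x \<in> ?L"
    then consider t u c v where "x = (node t (Suc t) u, c, node t (Suc t) v)"
        "a \<le> t" "t < a + l" "(u, c, v) \<in> mc_of A (p t)"
      | t i c j where "x = ((t, i), c, (t, j))" "a \<le> t" "t \<le> a + l"
        "(i, c, j) \<in> inv_of A (flow_point A p t)"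
      unfolding window_arcs_def by blast
    then show "x \<in> ?f ` ?R"
    proof cases
      case 1
      have "x = ?f (node (t - a) (Suc (t - a)) u, c, node (t - a) (Suc (t - a)) v)"
        using 1 by (simp add: map_arc_def node)
      moreover have "(node (t - a) (Suc (t - a)) u, c, node (t - a) (Suc (t - a)) v) \<in> ?R"
        unfolding window_arcs_def using 1
        by (intro UnI1 CollectI exI[of _ "t - a"] exI[of _ u] exI[of _ c] exI[of _ v]) auto
      ultimately show ?thesis by blast
    next
      case 2
      have "x = ?f ((t - a, i), c, (t - a, j))"
        using 2 by (simp add: map_arc_def)
      moreover have "((t - a, i), c, (t - a, j)) \<in> ?R"
        unfolding window_arcs_def using 2 by (auto simp: flow_point_shift)
      ultimately show ?thesis by blast
    qed
  qed
qed

lemma window_arcs_shiftI: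
  "(x, c, y) \<in> window_arcs A (\<lambda>t. p (a + t)) 0 l \<Longrightarrow>
     (map_prod ((+) a) id x, c, map_prod ((+) a) id y) \<in> window_arcs A p a (a + l)"
  unfolding window_arcs_shift by (rule image_eqI) (simp_all add: map_arc_def)

text \<open>The predicate \<open>P\<close> lets one proof cover both the existence of a walk and
  that of a descending walk. Adding \<open>a\<close> and subtracting \<open>a\<close> are the two
  homomorphisms.\<close>

lemma awalk_window_shift_iff:
  "(\<exists>w. pre_digraph.awalk (window n A (\<lambda>t. p (a + t)) 0 l) (node 0 l u) w (node 0 l v) \<and> P (descending w))
   \<longleftrightarrow> (\<exists>w. pre_digraph.awalk (window n A p a (a + l)) (node a (a + l) u) w (node a (a + l) v)
        \<and> P (descending w))" (is "?L \<longleftrightarrow> ?R")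
proof
  let ?f = "map_prod ((+) a) id :: nat \<times> nat \<Rightarrow> _" and ?g = "map_prod (\<lambda>t. t - a) id :: nat \<times> nat \<Rightarrow> _"
  have f: "?f (node 0 l u) = node a (a + l) u" for u by (cases u) simp_all
  have g: "?g (node a (a + l) u) = node 0 l u" for u by (cases u) simp_all
  show ?R if ?L
  proof -
    from that obtain w where
      "pre_digraph.awalk (window n A (\<lambda>t. p (a + t)) 0 l) (node 0 l u) w (node 0 l v)" "P (descending w)"
      by blast
    then have "pre_digraph.awalk (window n A p a (a + l)) (?f (node 0 l u)) (map (map_arc ?f) w) (?f (node 0 l v))"
      unfolding window_def by (elim awalk_map_arc) (auto dest!: window_arcs_shiftI)
    then show ?thesis using \<open>P _\<close> unfolding f
      by (intro exI[of _ "map (map_arc ?f) w"]) simp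
  qed
  show ?L if ?R
  proof -
    from that obtain w where
      "pre_digraph.awalk (window n A p a (a + l)) (node a (a + l) u) w (node a (a + l) v)" "P (descending w)"
      by blast
    then have "pre_digraph.awalk (window n A (\<lambda>t. p (a + t)) 0 l)
        (?g (node a (a + l) u)) (map (map_arc ?g) w) (?g (node a (a + l) v))"
      unfolding window_def by (elim awalk_map_arc) (auto simp: window_arcs_shift map_arc_def)
    then show ?thesis using \<open>P _\<close> unfolding g
      by (intro exI[of _ "map (map_arc ?g) w"]) simp
  qed
qed

text \<open>Makes the collapse of a segment, defined by a multipath restarted at time 0, readable
  from walks inside the infinite multipath.\<close>

lemma collapse_shift:
  assumes "a \<le> b"
  shows "collapse n A (b - a) (\<lambda>t. p (a + t)) =
    {(u, c, v). u \<in> mc_vars n \<and> v \<in> mc_vars n \<and>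
       (\<exists>w. pre_digraph.awalk (window n A p a b) (node a b u) w (node a b v)) \<and>
       (c = Gt \<longleftrightarrow>
         (\<exists>w. pre_digraph.awalk (window n A p a b) (node a b u) w (node a b v) \<and> descending w))}"
proof -
  obtain l where l: "b = a + l" using assms le_iff_add by blast
  show ?thesis
    unfolding collapse_def multipath_eq_window l diff_add_inverse
      awalk_window_shift_iff[where P = "\<lambda>d. d"]
      awalk_window_shift_iff[where P = "\<lambda>_. True", simplified] by simp
qed

lemma satisfiable_window_imp_not_infinitely_descending:
  assumes sat: "satisfiable (multipath n A (enat (b - a)) (\<lambda>t. p (a + t)))" and "a \<le> b"
    and w: "\<And>k. w k \<in> window_arcs A p a b" "\<And>k. snd (snd (w k)) = fst (w (Suc k))"
  shows "\<not> infinitely_descending w"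
proof -
  obtain l where l: "b = a + l" using assms(2) le_iff_add by blast
  let ?g = "map_arc (map_prod (\<lambda>t. t - a) id :: nat \<times> nat \<Rightarrow> _)"
  have in_arcs: "?g (w k) \<in> window_arcs A (\<lambda>t. p (a + t)) 0 l" for k
    using w(1)[of k] by (auto simp: l window_arcs_shift map_arc_def)
  have "head (window n A (\<lambda>t. p (a + t)) 0 l) (?g (w k)) = 
      tail (window n A (\<lambda>t. p (a + t)) 0 l) (?g (w (Suc k)))" for k
    using w(2)[of k] by (cases "w k"; cases "w (Suc k)") (simp add: window_def map_arc_def)
  then have "inf_walk (window n A (\<lambda>t. p (a + t)) 0 l) (\<lambda>k. ?g (w k))"
    using in_arcs by (simp add: inf_walk_def) (simp add: window_def)
  then have "\<not> infinitely_descending (\<lambda>k. ?g (w k))"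
    using satisfiable_imp_not_infinitely_descending sat
    unfolding multipath_eq_window window_def l by fastforce
  then show ?thesis by (simp add: infinitely_descending_def)
qed

text \<open>A descending cycle in the segment, moved to its place in the infinite multipath and
  repeated, would be an infinitely descending walk.\<close>

lemma satisfiable_shift_if_not_infinitely_descending:
  assumes "\<not> (\<exists>w. inf_walk (multipath n A \<infinity> p) w \<and> infinitely_descending w)"
  shows "satisfiable (multipath n A (enat l) (\<lambda>t. p (a + t)))"
proof -
  interpret shift: mcs_path n A "\<lambda>t. p (a + t)" by (rule shift_path)
  let ?f = "map_prod ((+) a) id :: nat \<times> nat \<Rightarrow> _"
  show ?thesis
    unfolding multipath_eq_window window_def
  proof (rule satisfiable_if_no_descending_cycle)
    show "wf_digraph (ldigraph ({0..l} \<times> {1..n}) (window_arcs A (\<lambda>t. p (a + t)) 0 l))"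
      using shift.wf_window[of 0 l] by (simp add: window_def)
    fix u w
    assume cyc: "pre_digraph.awalk
      (ldigraph ({0..l} \<times> {1..n}) (window_arcs A (\<lambda>t. p (a + t)) 0 l)) u w u"
    have "pre_digraph.awalk (window n A p a (a + l)) (?f u) (map (map_arc ?f) w) (?f u)"
      unfolding window_def using cyc
      by (rule awalk_map_arc) (auto dest!: window_arcs_shiftI)
    then have "pre_digraph.awalk (multipath n A \<infinity> p) (?f u) (map (map_arc ?f) w) (?f u)"
      by (rule awalk_window_imp_awalk_multipath)
    then have "\<not> descending (map (map_arc ?f) w)"
      using infinitely_descending_concat[of "multipath n A \<infinity> p" "\<lambda>_. ?f u" "\<lambda>_. map (map_arc ?f) w"]
        assms by blast
    then show "\<not> descending w" by simp
  qed simp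
qed

end


section \<open>Paths whose consecutive segments have the same collapse\<close>

lemma wf_circular_variant:
  assumes "G \<subseteq> mc_vars n \<times> UNIV \<times> mc_vars n"
  shows "wf_digraph (circular_variant n G)"
  using assms by unfold_locales (auto simp: circular_variant_def mc_vars_def)

lemma num_forward_simps [simp]:
  "num_forward [] = 0" "num_forward (Arc x # w) = num_forward w"
  "num_forward (Forward i # w) = Suc (num_forward w)" "num_forward (Backward i # w) = num_forward w"
  "num_forward (w @ w') = num_forward w + num_forward w'"
  by (simp_all add: num_forward_def)

lemma num_backward_simps [simp]:
  "num_backward [] = 0" "num_backward (Arc x # w) = num_backward w"
  "num_backward (Forward i # w) = num_backward w" "num_backward (Backward i # w) = Suc (num_backward w)"
  "num_backward (w @ w') = num_backward w + num_backward w'"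
  by (simp_all add: num_backward_def)

lemma descending_cycle_simps [simp]:
  "descending_cycle [] \<longleftrightarrow> False"
  "descending_cycle (Arc x # w) \<longleftrightarrow> strict x \<or> descending_cycle w"
  "descending_cycle (Forward i # w) \<longleftrightarrow> descending_cycle w"
  "descending_cycle (Backward i # w) \<longleftrightarrow> descending_cycle w"
  "descending_cycle (w @ w') \<longleftrightarrow> descending_cycle w \<or> descending_cycle w'"
  by (auto simp: descending_cycle_def simp del: split_paired_Ex)

text \<open>\<open>T c\<close> and \<open>T (Suc c)\<close> bound copy \<open>c\<close> of
  \<open>G\<close>. \<open>T 0\<close> may be positive, since Ramsey's theorem does not control
  where the first segment begins.\<close>

locale homogeneous_path = mcs_path n A p
  for n :: nat and A :: "('f, 'e) mcs" and p :: "nat \<Rightarrow> 'e" +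
  fixes T :: "nat \<Rightarrow> nat" and G :: mc
  assumes T: "strict_mono T"
    and collapse_eq: "collapse n A (T (Suc c) - T c) (\<lambda>t. p (T c + t)) = G"
begin

abbreviation walk :: "nat \<times> nat \<Rightarrow> (nat \<times> nat) constr list \<Rightarrow> nat \<times> nat \<Rightarrow> bool" where
  "walk \<equiv> pre_digraph.awalk (multipath n A \<infinity> p)"

abbreviation walk_in :: "nat \<Rightarrow> nat \<times> nat \<Rightarrow> (nat \<times> nat) constr list \<Rightarrow> nat \<times> nat \<Rightarrow> bool" where
  "walk_in c \<equiv> pre_digraph.awalk (window n A p (T c) (T (Suc c)))"

abbreviation circ_walk :: "var \<Rightarrow> circ_arc list \<Rightarrow> var \<Rightarrow> bool" where
  "circ_walk \<equiv> pre_digraph.awalk (circular_variant n G)"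

abbreviation copy :: "nat \<Rightarrow> var \<Rightarrow> nat \<times> nat" where
  "copy c \<equiv> node (T c) (T (Suc c))"

lemma T_less: "T c < T (Suc c)"
  using T by (simp add: strict_mono_Suc_iff)

text \<open>\<open>G\<close> does not depend on \<open>c\<close>: a walk inside one copy gives an
  arc of \<open>G\<close>, and this arc is realised by a walk inside every copy.\<close>

lemma G_iff:
  "(u, x, v) \<in> G \<longleftrightarrow> u \<in> mc_vars n \<and> v \<in> mc_vars n \<and> (\<exists>w. walk_in c (copy c u) w (copy c v)) \<and>
     (x = Gt \<longleftrightarrow> (\<exists>w. walk_in c (copy c u) w (copy c v) \<and> descending w))"
  unfolding collapse_eq[of c, symmetric] collapse_shift[OF less_imp_le[OF T_less]] by simp

lemma G_subset: "G \<subseteq> mc_vars n \<times> UNIV \<times> mc_vars n"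
  using collapse_subset collapse_eq[of 0] by metis

lemma G_walk:
  assumes "(u, x, v) \<in> G"
  shows "\<exists>w. walk_in c (copy c u) w (copy c v) \<and> (x = Gt \<longrightarrow> descending w)"
  using assms unfolding G_iff[of u x v c] by blast

lemma walk_G:
  assumes "walk_in c (copy c u) w (copy c v)" "u \<in> mc_vars n" "v \<in> mc_vars n"
  shows "\<exists>x. (u, x, v) \<in> G \<and> (descending w \<longrightarrow> x = Gt)"
\<comment> \<open>The label reflects all walks between the two nodes: the arc is strict if any of
  them descends, even if \<open>w\<close> does not.\<close>
proof (cases "\<exists>w. walk_in c (copy c u) w (copy c v) \<and> descending w")
  case True
  then show ?thesis using assms unfolding G_iff[of u _ v c] by blast
next
  case False
  then have "(u, Ge, v) \<in> G" using assms unfolding G_iff[of u _ v c] by auto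
  then show ?thesis using False assms(1) by blast
qed

sublocale circ: wf_digraph "circular_variant n G"
  by (rule wf_circular_variant[OF G_subset])

sublocale path: wf_digraph "multipath n A \<infinity> p"
  by (rule wf_multipath)

section \<open>Unfolding cycles into infinitely descending walks\<close>

lemma circ_walk_vars: "circ_walk u w v \<Longrightarrow> u \<in> mc_vars n \<and> v \<in> mc_vars n"
  using circ.awalk_hd_in_verts circ.awalk_last_in_verts by (auto simp: circular_variant_def)

text \<open>Shortcut edges are free: \<open>x\<^sub>i'\<close> of one copy of \<open>G\<close> and \<open>x\<^sub>i\<close> of the next are the same
  node of the multipath. Hence a walk in the circular variant unfolds to a walk of the multipath,
  provided that it does not leave the multipath at time 0.\<close>

lemma unfold_circ_walk:
  assumes "circ_walk u w v" "num_forward w \<le> c"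
  shows "\<exists>c' w'. walk (copy c u) w' (copy c' v) \<and> c' + num_forward w = c + num_backward w \<and>
    (descending_cycle w \<longrightarrow> descending w')"
  using assms
proof (induction w arbitrary: u c)
  case Nil
  then have "u = v" "u \<in> mc_vars n"
    using circ_walk_vars[OF Nil.prems(1)] by (simp_all add: circ.awalk_Nil_iff)
  then have "copy c u \<in> verts (multipath n A \<infinity> p)"
    by (auto simp: multipath_def mc_vars_def)
  then show ?case using \<open>u = v\<close> by (intro exI[of _ c] exI[of _ "[]"]) (simp add: path.awalk_Nil_iff)
next
  case (Cons a w)
  let ?C = "circular_variant n G"
  have a: "a \<in> arcs ?C" "u = circ_tail a" and w: "circ_walk (circ_head a) w v"
    using Cons.prems(1) by (auto simp: circ.awalk_Cons_iff) (auto simp: circular_variant_def)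
  show ?case
  proof (cases a)
    case (Arc e)
    obtain y x z where e: "e = (y, x, z)" by (cases e)
    have "(y, x, z) \<in> G" using a(1) Arc e by (auto simp: circular_variant_def)
    then obtain w1 where w1: "walk (copy c y) w1 (copy c z)" "x = Gt \<longrightarrow> descending w1"
      using G_walk awalk_window_imp_awalk_multipath by blast
    obtain c' w' where w': "walk (copy c z) w' (copy c' v)"
      "c' + num_forward w = c + num_backward w" "descending_cycle w \<longrightarrow> descending w'"
      using Cons.IH[of z c] w Cons.prems(2) Arc e by auto
    have "walk (copy c y) (w1 @ w') (copy c' v)" using w1(1) w'(1) by (rule pre_digraph.awalk_append)
    then show ?thesis using w1(2) w' a(2) Arc e
      by (intro exI[of _ c'] exI[of _ "w1 @ w'"]) auto
  next
    case (Forward i)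
    \<comment> \<open>The bound on \<open>num_forward\<close> counts this edge, so \<open>c\<close>
      is positive and a previous copy exists.\<close>
    then obtain d where d: "c = Suc d" using Cons.prems(2) by (cases c) auto
    show ?thesis using Cons.IH[of "Tgt i" d] w Cons.prems(2) Forward a(2) d by auto
  next
    case (Backward i)
    have "\<exists>c' w'. walk (copy (Suc c) (Src i)) w' (copy c' v) \<and>
        c' + num_forward w = Suc c + num_backward w \<and> (descending_cycle w \<longrightarrow> descending w')"
      using Cons.IH[of "Src i" "Suc c"] w Cons.prems(2) Backward by simp
    then show ?thesis using Backward a(2) by simp
  qed
qed

lemma passes_imp_infinitely_descending:
  assumes "passes_local_termination_test n G"
  shows "\<exists>w. inf_walk (multipath n A \<infinity> p) w \<and> infinitely_descending w"
proof -
  obtain w u where w: "circ_walk u w u" "descending_cycle w" "num_forward w \<le> num_backward w"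
    using assms unfolding passes_local_termination_test_def is_cycle_def
      forward_cycle_def balanced_cycle_def by auto
  \<comment> \<open>Round \<open>k\<close> starts here. The offset \<open>num_forward w\<close>
    leaves room for the forward edges of one round; each round advances by the surplus of backward
    edges, which is 0 for a balanced cycle.\<close>
  define v where "v k = copy (num_forward w + k * (num_backward w - num_forward w)) u" for k
  have "\<exists>w'. walk (v k) w' (v (Suc k)) \<and> descending w'" for k
  proof -
    obtain c' w' where w': "walk (v k) w' (copy c' u)" "descending w'"
      and c': "c' + num_forward w = num_forward w + k * (num_backward w - num_forward w) + num_backward w"
      using unfold_circ_walk[OF w(1), of "num_forward w + k * (num_backward w - num_forward w)"] w(2)
      by (auto simp: v_def)
    have "c' = num_forward w + Suc k * (num_backward w - num_forward w)" using c' w(3) by simp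
    then show ?thesis using w' unfolding v_def by blast
  qed
  then obtain W where "\<And>k. walk (v k) (W k) (v (Suc k)) \<and> descending (W k)" by metis
  then show ?thesis using infinitely_descending_concat[of _ v W] by blast
qed

section \<open>Folding infinitely descending walks into cycles\<close>

text \<open>A walk of the multipath from \<open>x[T b, i]\<close> to \<open>a\<close> is folded into a walk of the circular
  variant followed by a walk inside copy \<open>c\<close> that has not yet been collapsed to an arc;
  the surplus of backward shortcuts is the number \<open>c - b\<close> of copies advanced, and \<open>d\<close> records
  descent.\<close>

definition folds :: "nat \<Rightarrow> nat \<Rightarrow> nat \<Rightarrow> nat \<times> nat \<Rightarrow> bool \<Rightarrow> bool" where
  "folds i b c a d \<longleftrightarrow> (\<exists>w u w'. circ_walk (Src i) w u \<and> walk_in c (copy c u) w' a \<and>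
     b + num_backward w = c + num_forward w \<and> (d \<longrightarrow> descending_cycle w \<or> descending w'))"

lemma folds_start:
  assumes "i \<in> {1..n}"
  shows "folds i b b (T b, i) False"
proof -
  interpret W: wf_digraph "window n A p (T b) (T (Suc b))" by (rule wf_window)
  have "circ_walk (Src i) [] (Src i)" "walk_in b (copy b (Src i)) [] (T b, i)"
    using assms T_less[of b] unfolding circ.awalk_Nil_iff W.awalk_Nil_iff
    by (auto simp: circular_variant_def window_def mc_vars_def)
  then show ?thesis unfolding folds_def
    by (intro exI[of _ "[]"] exI[of _ "Src i"]) simp
qed

lemma folds_arc:
  assumes "folds i b c a d" "(a, x, a') \<in> window_arcs A p (T c) (T (Suc c))"
  shows "folds i b c a' (d \<or> x = Gt)"
proof -
  interpret W: wf_digraph "window n A p (T c) (T (Suc c))" by (rule wf_window)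
  obtain w u w' where w: "circ_walk (Src i) w u" "walk_in c (copy c u) w' a"
    "b + num_backward w = c + num_forward w" "d \<longrightarrow> descending_cycle w \<or> descending w'"
    using assms(1) unfolding folds_def by blast
  have "walk_in c a [(a, x, a')] a'"
    using W.awalk_arc[of "(a, x, a')"] assms(2) by (simp add: window_def)
  then have "walk_in c (copy c u) (w' @ [(a, x, a')]) a'"
    using w(2) W.awalk_append by blast
  then show ?thesis using w(1,3,4) unfolding folds_def
    by (intro exI[of _ w] exI[of _ u] exI[of _ "w' @ [(a, x, a')]"]) auto
qed

text \<open>The pending walk between variables of copy \<open>c\<close> becomes an arc of
  \<open>G\<close> by \<open>walk_G\<close>, strict if the walk descends. An empty one becomes a
  loop, as empty walks count in the collapse.\<close>

lemma folds_collapse: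
  assumes "folds i b c (copy c v) d" "v \<in> mc_vars n"
  shows "\<exists>w. circ_walk (Src i) w v \<and> b + num_backward w = c + num_forward w \<and>
    (d \<longrightarrow> descending_cycle w)"
proof -
  obtain w u w' where w: "circ_walk (Src i) w u" "walk_in c (copy c u) w' (copy c v)"
    "b + num_backward w = c + num_forward w" "d \<longrightarrow> descending_cycle w \<or> descending w'"
    using assms(1) unfolding folds_def by blast
  obtain x where x: "(u, x, v) \<in> G" "descending w' \<longrightarrow> x = Gt"
    using walk_G[OF w(2)] circ_walk_vars[OF w(1)] assms(2) by blast
  have "circ_walk u [Arc (u, x, v)] v"
    using circ.awalk_arc[of "Arc (u, x, v)"] x(1) by (simp add: circular_variant_def)
  with w(1) have "circ_walk (Src i) (w @ [Arc (u, x, v)]) v" by (rule circ.awalk_append)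
  then show ?thesis using w(3,4) x(2) by (intro exI[of _ "w @ [Arc (u, x, v)]"]) auto
qed

lemma folds_shortcut:
  assumes w: "circ_walk (Src i) w u" "d \<longrightarrow> descending_cycle w"
    and e: "e = Forward j \<or> e = Backward j" "j \<in> {1..n}" "circ_tail e = u"
    and c: "b + num_backward (w @ [e]) = c + num_forward (w @ [e])"
  shows "folds i b c (copy c (circ_head e)) d"
proof -
  interpret W: wf_digraph "window n A p (T c) (T (Suc c))" by (rule wf_window)
  have "circ_walk u [e] (circ_head e)"
    using circ.awalk_arc[of e] e by (auto simp: circular_variant_def)
  with w(1) have "circ_walk (Src i) (w @ [e]) (circ_head e)" by (rule circ.awalk_append)
  moreover have "walk_in c (copy c (circ_head e)) [] (copy c (circ_head e))"
    using e T_less[of c] unfolding W.awalk_Nil_iff by (auto simp: window_def)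
  moreover have "d \<longrightarrow> descending_cycle (w @ [e])" using w(2) by simp
  ultimately show ?thesis using c unfolding folds_def by blast
qed

text \<open>The node is \<open>x_j'\<close> of copy \<open>c\<close> and \<open>x_j\<close> of the
  next copy. Changing from the first view to the second costs one backward shortcut;
  \<open>folds_prev\<close> reverses this with a forward one.\<close>

lemma folds_next:
  assumes "folds i b c (T (Suc c), j) d" "j \<in> {1..n}"
  shows "folds i b (Suc c) (T (Suc c), j) d"
proof -
  have "Tgt j \<in> mc_vars n" using assms(2) by (simp add: mc_vars_def)
  then obtain w where "circ_walk (Src i) w (Tgt j)" "b + num_backward w = c + num_forward w"
    "d \<longrightarrow> descending_cycle w"
    using folds_collapse[of i b c "Tgt j" d] assms(1) by auto
  then show ?thesis
    using folds_shortcut[of i w "Tgt j" d "Backward j" j b "Suc c"] assms(2) by simp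
qed

lemma folds_prev:
  assumes "folds i b (Suc c) (T (Suc c), j) d" "j \<in> {1..n}"
  shows "folds i b c (T (Suc c), j) d"
proof -
  have "Src j \<in> mc_vars n" using assms(2) by (simp add: mc_vars_def)
  then obtain w where "circ_walk (Src i) w (Src j)" "b + num_backward w = Suc c + num_forward w"
    "d \<longrightarrow> descending_cycle w"
    using folds_collapse[of i b "Suc c" "Src j" d] assms(1) by auto
  then show ?thesis
    using folds_shortcut[of i w "Src j" d "Forward j" j b c] assms(2) by simp
qed

lemma adjacent_windows:
  assumes "t \<in> {T c..T (Suc c)}" "t \<in> {T c'..T (Suc c')}"
  obtains "c' = c" | "c' = Suc c" "t = T (Suc c)" | "c = Suc c'" "t = T (Suc c')"
proof -
  have "T c \<le> T (Suc c')" "T c' \<le> T (Suc c)" using assms by simp_all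
  then have "c \<le> Suc c'" "c' \<le> Suc c" using T by (simp_all add: strict_mono_less_eq)
  then consider "c' = c" | "c' = Suc c" | "c = Suc c'" by linarith
  then show ?thesis using assms that by cases auto
qed

text \<open>Used when the next arc lies in another copy: the current node belongs to both, so the
  copies are equal or neighbours meeting at that node, and one shortcut suffices.\<close>

lemma folds_switch:
  assumes "folds i b c (t, j) d" "t \<in> {T c'..T (Suc c')}"
  shows "folds i b c' (t, j) d"
proof -
  interpret W: wf_digraph "window n A p (T c) (T (Suc c))" by (rule wf_window)
  have "(t, j) \<in> verts (window n A p (T c) (T (Suc c)))"
    using assms(1) W.awalk_last_in_verts unfolding folds_def by blast
  then have t: "t \<in> {T c..T (Suc c)}" and j: "j \<in> {1..n}" by (simp_all add: window_def)
  from t assms(2) show ?thesis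
    by (rule adjacent_windows) (use assms(1) j folds_next folds_prev in auto)
qed

lemma arc_in_window:
  assumes T0: "T 0 = 0" and a: "a \<in> arcs (multipath n A \<infinity> p)"
  shows "\<exists>c. a \<in> window_arcs A p (T c) (T (Suc c))"
proof -
  have copy: "\<exists>c. T c \<le> t \<and> t < T (Suc c)" for t
  proof (induction t)
    case 0
    show ?case using T_less[of 0] T0 by (intro exI[of _ 0]) simp
  next
    case (Suc t)
    then obtain c where c: "T c \<le> t" "t < T (Suc c)" by blast
    show ?case
    proof (cases "Suc t = T (Suc c)")
      case True
      then show ?thesis using T_less[of "Suc c"] by (intro exI[of _ "Suc c"]) simp
    next
      case False
      then show ?thesis using c by (intro exI[of _ c]) simp
    qed
  qed
  \<comment> \<open>The arc has a time \<open>t\<close>: it comes from the MC between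
    \<open>t\<close> and \<open>Suc t\<close> or from the invariant at \<open>t\<close>. Any segment
    that covers this unit interval contains it.\<close>
  have "\<exists>t. \<forall>l h. l \<le> t \<longrightarrow> t < h \<longrightarrow> a \<in> window_arcs A p l h"
    using a unfolding multipath_def window_arcs_def by simp (blast intro: less_imp_le)
  then show ?thesis using copy by blast
qed

lemma infinitely_descending_imp_passes:
  assumes T0: "T 0 = 0"
    and sat: "\<And>c. satisfiable (multipath n A (enat (T (Suc c) - T c)) (\<lambda>t. p (T c + t)))"
    and w: "inf_walk (multipath n A \<infinity> p) w" and inf: "infinitely_descending w"
  shows "passes_local_termination_test n G"
proof -
  define a where "a s = fst (w s)" for s
  define lab where "lab s = fst (snd (w s))" for s
  have w_eq: "w s = (a s, lab s, a (Suc s))" for s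
  proof -
    have "head (multipath n A \<infinity> p) (w s) = tail (multipath n A \<infinity> p) (w (Suc s))"
      using w by (simp add: inf_walk_def)
    then have "snd (snd (w s)) = a (Suc s)"
      unfolding multipath_def a_def by (cases "w s"; cases "w (Suc s)") simp
    then show ?thesis by (cases "w s") (simp add: a_def lab_def)
  qed
  have "\<exists>c. w s \<in> window_arcs A p (T c) (T (Suc c))" for s
    using arc_in_window[OF T0, of "w s"] w unfolding inf_walk_def by blast
  \<comment> \<open>\<open>C s\<close> is a copy that contains arc number \<open>s\<close>; an arc
    at a boundary may lie in two copies, and either choice will do.\<close>
  then obtain C where C: "\<And>s. w s \<in> window_arcs A p (T (C s)) (T (Suc (C s)))" by metis
  have ends: "a s \<in> {T (C s)..T (Suc (C s))} \<times> {1..n}"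
    "a (Suc s) \<in> {T (C s)..T (Suc (C s))} \<times> {1..n}" for s
    using window_arc_ends[OF C[of s, unfolded w_eq[of s]]] by blast+

  \<comment> \<open>A tail of the walk that avoids all boundary times stays in one copy, whose
    satisfiability forbids infinitely many strict arcs.\<close>
  have boundary: "\<exists>s\<ge>m. fst (a s) \<in> range T" for m
  proof (rule ccontr)
    assume "\<not> ?thesis"
    then have interior: "fst (a s) \<noteq> T c" if "m \<le> s" for s c using that by auto
    have C_const: "C s = C m" if "m \<le> s" for s
      using that
    proof (induction rule: dec_induct)
      case (step s)
      have "fst (a (Suc s)) \<in> {T (C s)..T (Suc (C s))}"
        "fst (a (Suc s)) \<in> {T (C (Suc s))..T (Suc (C (Suc s)))}"
        using ends(2)[of s] ends(1)[of "Suc s"] by (simp_all add: mem_Times_iff)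
      then have "C (Suc s) = C s"
        by (rule adjacent_windows) (use interior[of "Suc s"] step in auto)
      then show ?case using step by simp
    qed simp
    have "\<not> infinitely_descending (\<lambda>s. w (m + s))"
    proof (rule satisfiable_window_imp_not_infinitely_descending[OF sat[of "C m"]])
      show "w (m + s) \<in> window_arcs A p (T (C m)) (T (Suc (C m)))" for s
        using C[of "m + s"] C_const[of "m + s"] by simp
      show "snd (snd (w (m + s))) = fst (w (m + Suc s))" for s
        using w_eq[of "m + s"] by (metis a_def add_Suc_right snd_conv)
    qed (use T_less in \<open>simp add: less_imp_le\<close>)
    moreover have "infinitely_descending (\<lambda>s. w (m + s))"
      unfolding infinitely_descending_def INFM_nat_le
    proof
      fix k
      obtain s where "m + k \<le> s" "strict (w s)"
        using inf unfolding infinitely_descending_def INFM_nat_le by blast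
      then show "\<exists>s\<ge>k. strict (w (m + s))" by (intro exI[of _ "s - m"]) auto
    qed
    ultimately show False by blast
  qed
  define S where "S = {s. fst (a s) \<in> range T}"
  have "infinite S" unfolding infinite_nat_iff_unbounded_le S_def using boundary by blast
  moreover have "(\<lambda>s. snd (a s)) ` S \<subseteq> {1..n}" using ends(1) by (auto simp: mem_Times_iff)
  ultimately obtain s0 where inf_s0: "infinite {s \<in> S. snd (a s) = snd (a s0)}"
    using pigeonhole_infinite[of S "\<lambda>s. snd (a s)"] finite_subset by blast
  define i where "i = snd (a s0)"
  have i: "i \<in> {1..n}" using ends(1)[of s0] by (auto simp: i_def mem_Times_iff)
  define B where "B = {(b, s). a s = (T b, i)}"
  have B_inf: "\<exists>b s. m \<le> s \<and> (b, s) \<in> B" for m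
  proof -
    obtain s where "m \<le> s" "s \<in> S" "snd (a s) = i"
      using inf_s0 unfolding infinite_nat_iff_unbounded_le i_def by blast
    then show ?thesis unfolding B_def S_def by (cases "a s") auto
  qed
  \<comment> \<open>Starting in the earliest copy ensures b \<le> b' for the later visit, so the
    folded cycle has at least as many backward as forward shortcuts.\<close>
  define b where "b = (LEAST b. \<exists>s. (b, s) \<in> B)"
  have "\<exists>s. (b, s) \<in> B" unfolding b_def by (rule LeastI_ex) (use B_inf in blast)
  then obtain s where s: "a s = (T b, i)" by (auto simp: B_def)
  \<comment> \<open>The second visit \<open>s'\<close> is chosen after the strict arc
    \<open>r\<close>, so that the stretch from \<open>s\<close> to \<open>s'\<close>
    descends.\<close>
  obtain r where r: "s \<le> r" "strict (w r)"
    using inf unfolding infinitely_descending_def INFM_nat_le by blast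
  obtain b' s' where s': "Suc r \<le> s'" "(b', s') \<in> B" using B_inf by blast
  have "b \<le> b'" unfolding b_def by (rule Least_le) (use s' in blast)
  define D where "D m \<longleftrightarrow> (\<exists>k. s \<le> k \<and> k < m \<and> strict (w k))" for m
  have D_base: "D s = False" by (simp add: D_def)
  have D_Suc: "D (Suc m) \<longleftrightarrow> D m \<or> lab m = Gt" if "s \<le> m" for m
    using that unfolding D_def lab_def strict_iff[symmetric] by (auto simp: less_Suc_eq)
  \<comment> \<open>Before each arc the folding is switched to the copy \<open>C m\<close> of that
    arc. The walk may go back before copy \<open>b\<close> in between; the equation in
    \<open>folds\<close> covers this because it avoids subtraction.\<close>
  have fold: "\<exists>c. folds i b c (a m) (D m)" if "s \<le> m" for m
    using that
  proof (induction rule: dec_induct)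
    case base
    show ?case unfolding D_base s using folds_start[OF i] by blast
  next
    case (step m)
    then obtain c where c: "folds i b c (a m) (D m)" by blast
    have "fst (a m) \<in> {T (C m)..T (Suc (C m))}" using ends(1)[of m] by (simp add: mem_Times_iff)
    then have "folds i b (C m) (a m) (D m)"
      using folds_switch[of i b c "fst (a m)" "snd (a m)"] c by simp
    moreover have "(a m, lab m, a (Suc m)) \<in> window_arcs A p (T (C m)) (T (Suc (C m)))"
      using C[of m] by (subst w_eq[symmetric])
    ultimately show ?case unfolding D_Suc[OF step.hyps(1)] by (blast intro: folds_arc)
  qed
  have "D s'" using r s'(1) unfolding D_def by (intro exI[of _ r]) simp
  then obtain c where "folds i b c (T b', i) True"
    using fold[of s'] r(1) s' by (auto simp: B_def)
  then have "folds i b b' (copy b' (Src i)) True"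
    using folds_switch T_less[of b'] by simp
  then obtain x where "circ_walk (Src i) x (Src i)" "b + num_backward x = b' + num_forward x"
    "descending_cycle x"
    using folds_collapse[of i b b' "Src i" True] i by (auto simp: mc_vars_def)
  moreover from this have "x \<noteq> []" by auto
  ultimately show ?thesis
    using \<open>b \<le> b'\<close> unfolding passes_local_termination_test_def is_cycle_def
      forward_cycle_def balanced_cycle_def by (intro exI[of _ x]) auto
qed

end


section \<open>Periodic and homogeneous infinite paths\<close>

lemma cfg_path_periodic:
  assumes path: "cfg_path A (enat l) p" and cyc: "flow_point A p 0 = flow_point A p l"
  shows "cfg_path A \<infinity> (\<lambda>t. p (t mod l))"
proof -
  have l: "0 < l" using path by (auto simp: cfg_path_def one_enat_def)
  have "head (cfg A) (p (t mod l)) = tail (cfg A) (p (Suc t mod l))" for t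
  proof (cases "Suc (t mod l) = l")
    case True
    then have "flow_point A p l = head (cfg A) (p (t mod l))" by (metis flow_point.simps(2))
    then show ?thesis using True cyc by (simp add: mod_Suc)
  next
    case False
    then have "Suc (t mod l) < l" using mod_less_divisor[OF l, of t] by linarith
    then show ?thesis using path False by (simp add: cfg_path_def mod_Suc)
  qed
  then show ?thesis using path l by (simp add: cfg_path_def)
qed

text \<open>Repeating the cyclic multipath forever gives a homogeneous path with boundaries at the
  multiples of \<open>l\<close>, all of whose segments are satisfiable.\<close>

lemma passes_if_size_change_terminating:
  assumes mcs: "mcs n A" and sct: "size_change_terminating n A"
    and path: "cfg_path A (enat l) p" and sat: "satisfiable (multipath n A (enat l) p)"
    and cyc: "flow_point A p 0 = flow_point A p l"
  shows "passes_local_termination_test n (collapse n A l p)"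
proof -
  define q where "q t = p (t mod l)" for t
  have l: "0 < l" using path by (auto simp: cfg_path_def one_enat_def)
  have q_path: "cfg_path A \<infinity> q" unfolding q_def by (rule cfg_path_periodic[OF path cyc])
  have seg: "multipath n A (enat l) (\<lambda>t. q (c * l + t)) = multipath n A (enat l) p" for c
    by (rule multipath_cong[OF l]) (simp add: q_def)
  interpret homogeneous_path n A q "\<lambda>c. c * l" "collapse n A l p"
    using mcs q_path l seg
    by unfold_locales (simp_all add: strict_mono_Suc_iff collapse_def)
  obtain w where "inf_walk (multipath n A \<infinity> q) w" "infinitely_descending w"
    using sct q_path unfolding size_change_terminating_def by blast
  then show ?thesis
    by (intro infinitely_descending_imp_passes) (simp_all add: seg sat)
qed

lemma finite_mcs_colors:
  assumes "mcs n A"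
  shows "finite (verts (cfg A) \<times> Pow (mc_vars n \<times> (UNIV :: label set) \<times> mc_vars n) \<times> verts (cfg A))"
proof -
  interpret fin_digraph "cfg A" using assms by (simp add: mcs_def)
  have "(UNIV :: label set) = {Gt, Ge}" using label.exhaust by blast
  then have "finite (UNIV :: label set)" by (metis finite.emptyI finite.insertI)
  then show ?thesis by (simp add: mc_vars_def)
qed

text \<open>A pair of times is coloured by the collapse between them and the flow-points at both.
  Ramsey's theorem gives an infinite set of times with one colour; consecutive elements bound the
  segments, and the common flow-point makes each collapse cyclic.\<close>

lemma (in mcs_path) homogeneous_subsequence:
  obtains T f G where "strict_mono T" "\<And>c. flow_point A p (T c) = f"
    "\<And>c. collapse n A (T (Suc c) - T c) (\<lambda>t. p (T c + t)) = G"
proof -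
  define K where "K = verts (cfg A) \<times> Pow (mc_vars n \<times> (UNIV :: label set) \<times> mc_vars n) \<times> verts (cfg A)"
  define color where "color a b = (flow_point A p a, collapse n A (b - a) (\<lambda>t. p (a + t)), flow_point A p b)" for a b
  have color: "color a b \<in> K" for a b
    using flow_point_in_verts collapse_subset unfolding color_def K_def by blast
  \<comment> \<open>\<open>h\<close> numbers the finitely many colours, since Ramsey's theorem is
    applied to colours that are numbers below \<open>m\<close>.\<close>
  obtain m :: nat and h where h: "h ` K = {k. k < m}" "inj_on h K"
    using finite_imp_inj_to_nat_seg finite_mcs_colors[OF mcs] unfolding K_def by metis
  have "\<exists>Y k. Y \<subseteq> (UNIV :: nat set) \<and> infinite Y \<and> k < m \<and>
      (\<forall>x\<in>Y. \<forall>y\<in>Y. x \<noteq> y \<longrightarrow> h (color (Min {x, y}) (Max {x, y})) = k)"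
    by (rule Ramsey2) (use h(1) color in auto)
  then obtain Y k where Y: "infinite Y"
    and mono: "\<forall>x\<in>Y. \<forall>y\<in>Y. x \<noteq> y \<longrightarrow> h (color (Min {x, y}) (Max {x, y})) = k"
    by (elim exE conjE) (rule that)
  define T where "T = enumerate Y"
  have T: "T c < T (Suc c)" for c unfolding T_def using Y by (rule enumerate_step)
  have "h (color (T c) (T (Suc c))) = k" for c
    using mono[rule_format, of "T c" "T (Suc c)"] T[of c] enumerate_in_set[OF Y]
    by (simp add: T_def max_def min_def)
  then have "color (T c) (T (Suc c)) = color (T 0) (T (Suc 0))" for c
    using color by (intro inj_onD[OF h(2)]) simp_all
  then have "flow_point A p (T c) = flow_point A p (T 0)"
    "collapse n A (T (Suc c) - T c) (\<lambda>t. p (T c + t)) =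
       collapse n A (T (Suc 0) - T 0) (\<lambda>t. p (T 0 + t))" for c
    by (simp_all add: color_def)
  moreover have "strict_mono T" using T by (simp add: strict_mono_Suc_iff)
  ultimately show ?thesis using that by metis
qed

text \<open>The argument is by contradiction because only satisfiable multipaths contribute to the
  closure set: without an infinitely descending walk the first segment is satisfiable, hence
  \<open>G\<close> passes the test, and unfolding its cycle produces such a walk.\<close>

lemma infinitely_descending_if_all_pass:
  assumes "mcs_path n A p"
    and pass: "\<And>f G. (f, G, f) \<in> closure_set n A \<Longrightarrow> passes_local_termination_test n G"
  shows "\<exists>w. inf_walk (multipath n A \<infinity> p) w \<and> infinitely_descending w"
proof (rule ccontr)
  assume none: "\<not> ?thesis"
  interpret mcs_path n A p by fact
  obtain T f G where T: "strict_mono T" and f: "\<And>c. flow_point A p (T c) = f"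
    and G: "\<And>c. collapse n A (T (Suc c) - T c) (\<lambda>t. p (T c + t)) = G"
    using homogeneous_subsequence by blast
  interpret homogeneous_path n A p T G using T G by unfold_locales
  interpret shift: mcs_path n A "\<lambda>t. p (T 0 + t)" by (rule shift_path)
  define l where "l = T (Suc 0) - T 0"
  have l: "0 < l" "T 0 + l = T (Suc 0)" using T_less[of 0] by (simp_all add: l_def)
  have "cfg_path A (enat l) (\<lambda>t. p (T 0 + t))"
    using shift.path l(1) by (auto simp: cfg_path_def one_enat_def)
  then have "(flow_point A (\<lambda>t. p (T 0 + t)) 0, collapse n A l (\<lambda>t. p (T 0 + t)),
      flow_point A (\<lambda>t. p (T 0 + t)) l) \<in> closure_set n A"
    by (rule closure_setI[OF _ satisfiable_shift_if_not_infinitely_descending[OF none]])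
  moreover have "flow_point A (\<lambda>t. p (T 0 + t)) 0 = f" "flow_point A (\<lambda>t. p (T 0 + t)) l = f"
    using f[of 0] f[of "Suc 0"] l(2) flow_point_shift[of "T 0" 0] flow_point_shift[of "T 0" l]
    by (simp_all del: flow_point.simps)
  moreover have "collapse n A l (\<lambda>t. p (T 0 + t)) = G" using G[of 0] by (simp add: l_def)
  ultimately have "(f, G, f) \<in> closure_set n A" by (simp only:)
  then have "passes_local_termination_test n G" by (rule pass)
  then show False using passes_imp_infinitely_descending none by blast
qed

theorem theorem4p12:
  fixes n :: nat and A :: "('f, 'e) mcs"
  assumes "mcs n A"
  shows "size_change_terminating n A \<longleftrightarrow>
    (\<forall>f G g. (f, G, g) \<in> closure_set n A \<and> cyclic (f, G, g) \<longrightarrow>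
       passes_local_termination_test n G)"
proof
  assume "size_change_terminating n A"
  then show "\<forall>f G g. (f, G, g) \<in> closure_set n A \<and> cyclic (f, G, g) \<longrightarrow>
      passes_local_termination_test n G"
    using passes_if_size_change_terminating[OF assms]
    by (auto simp: closure_set_def cyclic_def)
next
  assume "\<forall>f G g. (f, G, g) \<in> closure_set n A \<and> cyclic (f, G, g) \<longrightarrow>
      passes_local_termination_test n G"
  then show "size_change_terminating n A"
    using infinitely_descending_if_all_pass[of n A] assms
    unfolding size_change_terminating_def mcs_path_def cyclic_def by auto
qed

end
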